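(* Let $d\in\mathbb N$, $a\in\mathbb N_0$. For all integers $n\ge k\ge0$, $$rEu(d,a;n,k)=\sum_{j=0}^k(-1)^{k-j}\binom{n+1}{k-j}(a+d\,j)^n.$$
   Context: $\mathbb N=\{1,2,\dots\}$, $\mathbb N_0=\{0,1,2,\dots\}$, $0^0:=1$. The generalized Stirling numbers of the second kind $S2(d,a;n,m)$, $0\le m\le n$, are defined by the operator identity $(a\,\mathbf 1+d\,\mathbf E_x)^n=\sum_{m=0}^n S2(d,a;n,m)\,x^m\,\mathbf d_x^{\,m}$, where $\mathbf d_x$ is differentiation with respect to $x$, $\mathbf E_x:=x\,\mathbf d_x$ and $\mathbf 1$ is the identity operator. The generalized (row reversed) Eulerian numbers are defined, for $0\le k\le n$, by $rEu(d,a;n,k):=\sum_{j=0}^k(-1)^{k-j}\binom{n-j}{k-j}S2(d,a;n,j)\,j!$. *)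

theory Defs
  imports Complex_Main "HOL-Computational_Algebra.Polynomial"
begin

text \<open>Operators act on the polynomial ring \<open>\<real>[x]\<close>, on which the algebra generated by
  \<open>x\<close> and \<open>d\<^sub>x\<close> is faithfully represented.\<close>

definition euler_op :: "real poly \<Rightarrow> real poly" where
  "euler_op p = [:0, 1:] * pderiv p"

definition scaled_euler_op :: "nat \<Rightarrow> nat \<Rightarrow> real poly \<Rightarrow> real poly" where
  "scaled_euler_op d a p = smult (real a) p + smult (real d) (euler_op p)"

definition is_S2_row :: "nat \<Rightarrow> nat \<Rightarrow> nat \<Rightarrow> (nat \<Rightarrow> real) \<Rightarrow> bool" where
  "is_S2_row d a n c \<longleftrightarrow>
     (\<forall>p. (scaled_euler_op d a ^^ n) p
            = (\<Sum>m\<le>n. smult (c m) ([:0, 1:] ^ m * (pderiv ^^ m) p)))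
     \<and> (\<forall>m>n. c m = 0)"

text \<open>The operator identity only constrains the entries \<open>m \<le> n\<close>; extending by \<open>0\<close> makes the row
  a unique function, see \<open>is_S2_row_ex1\<close> below.\<close>

definition S2 :: "nat \<Rightarrow> nat \<Rightarrow> nat \<Rightarrow> nat \<Rightarrow> real" where
  "S2 d a n = (THE c. is_S2_row d a n c)"

definition rEu :: "nat \<Rightarrow> nat \<Rightarrow> nat \<Rightarrow> nat \<Rightarrow> real" where
  "rEu d a n k =
     (\<Sum>j=0..k. (- 1) ^ (k - j) * real ((n - j) choose (k - j)) * S2 d a n j * fact j)"

lemma scaled_euler_op_term:
  "scaled_euler_op d a ([:0, 1:] ^ m * (pderiv ^^ m) p) =
     smult (real a + real d * real m) ([:0, 1:] ^ m * (pderiv ^^ m) p)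
     + smult (real d) ([:0, 1:] ^ Suc m * (pderiv ^^ Suc m) p)"
proof -
  have "[:0, 1:] * pderiv ([:0, 1:] ^ m :: real poly) = smult (real m) ([:0, 1:] ^ m)"
  proof (cases m)
    case (Suc l)
    show ?thesis
      unfolding Suc pderiv_power_Suc by (simp add: pderiv_pCons)
  qed simp
  hence "euler_op ([:0, 1:] ^ m * (pderiv ^^ m) p) =
      smult (real m) ([:0, 1:] ^ m * (pderiv ^^ m) p) + [:0, 1:] ^ Suc m * (pderiv ^^ Suc m) p"
    unfolding euler_op_def pderiv_mult
    by (simp add: distrib_left mult.assoc mult.left_commute del: mult_pCons_left mult_pCons_right)
       (metis mult.assoc mult.commute mult_smult_right)
  thus ?thesis
    unfolding scaled_euler_op_def by (simp add: smult_add_right smult_add_left algebra_simps)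
qed

lemma scaled_euler_op_sum:
  "scaled_euler_op d a (\<Sum>m\<in>A. smult (c m) (f m)) = (\<Sum>m\<in>A. smult (c m) (scaled_euler_op d a (f m)))"
proof -
  have add: "scaled_euler_op d a (p + q) = scaled_euler_op d a p + scaled_euler_op d a q" for p q
    by (simp add: scaled_euler_op_def euler_op_def pderiv_add smult_add_right algebra_simps)
  have sm: "scaled_euler_op d a (smult s p) = smult s (scaled_euler_op d a p)" for s p
    by (simp add: scaled_euler_op_def euler_op_def pderiv_smult smult_add_right mult.commute)
  have z: "scaled_euler_op d a 0 = 0"
    by (simp add: scaled_euler_op_def euler_op_def)
  show ?thesis
    by (induction A rule: infinite_finite_induct) (simp_all add: add sm z)
qed

lemma is_S2_row_ex: "\<exists>c. is_S2_row d a n c"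
proof (induction n)
  case 0
  show ?case
    by (rule exI[of _ "\<lambda>m. if m = 0 then 1 else 0"]) (simp add: is_S2_row_def)
next
  case (Suc n)
  then obtain c where c: "\<And>p. (scaled_euler_op d a ^^ n) p
            = (\<Sum>m\<le>n. smult (c m) ([:0, 1:] ^ m * (pderiv ^^ m) p))" and c0: "\<And>m. m > n \<Longrightarrow> c m = 0"
    unfolding is_S2_row_def by blast
  define c' where "c' m = (real a + real d * real m) * c m
    + (case m of 0 \<Rightarrow> 0 | Suc l \<Rightarrow> real d * c l)" for m
  have "(scaled_euler_op d a ^^ Suc n) p
      = (\<Sum>m\<le>Suc n. smult (c' m) ([:0, 1:] ^ m * (pderiv ^^ m) p))" for p
  proof -
    define t where "t m = [:0, 1:] ^ m * (pderiv ^^ m) p" for m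
    have op: "scaled_euler_op d a (t m)
        = smult (real a + real d * real m) (t m) + smult (real d) (t (Suc m))" for m
      unfolding t_def by (rule scaled_euler_op_term)
    have "(scaled_euler_op d a ^^ Suc n) p = scaled_euler_op d a (\<Sum>m\<le>n. smult (c m) (t m))"
      by (simp add: c t_def)
    also have "\<dots> = (\<Sum>m\<le>n. smult ((real a + real d * real m) * c m) (t m))
        + (\<Sum>m\<le>n. smult (real d * c m) (t (Suc m)))"
      unfolding scaled_euler_op_sum op
      by (simp add: smult_add_right sum.distrib mult.commute)
    also have "(\<Sum>m\<le>n. smult ((real a + real d * real m) * c m) (t m))
        = (\<Sum>m\<le>Suc n. smult ((real a + real d * real m) * c m) (t m))"
      by (simp add: c0)
    also have "(\<Sum>m\<le>n. smult (real d * c m) (t (Suc m)))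
        = (\<Sum>m\<le>Suc n. smult (case m of 0 \<Rightarrow> 0 | Suc l \<Rightarrow> real d * c l) (t m))"
      by (subst sum.atMost_Suc_shift) simp
    finally show ?thesis
      by (simp only: c'_def t_def smult_add_left sum.distrib)
  qed
  moreover have "c' m = 0" if "m > Suc n" for m
    using that by (cases m) (auto simp: c'_def c0)
  ultimately show ?case
    unfolding is_S2_row_def by blast
qed

lemma pderiv_funpow_monom_self: "(pderiv ^^ k) (monom c k :: real poly) = monom (fact k * c) 0"
proof (induction k arbitrary: c)
  case (Suc k)
  thus ?case
    by (simp del: funpow.simps add: funpow_Suc_right pderiv_monom algebra_simps)
qed simp

lemma pderiv_funpow_monom_zero: "m > k \<Longrightarrow> (pderiv ^^ m) (monom c k :: real poly) = 0"
proof (induction m arbitrary: c k)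
  case (Suc m)
  have z: "(pderiv ^^ i) (0 :: real poly) = 0" for i
    by (induction i) simp_all
  show ?case
    using Suc by (cases k) (simp_all del: funpow.simps add: funpow_Suc_right pderiv_monom z)
qed simp

lemma is_S2_row_unique:
  assumes "is_S2_row d a n b" "is_S2_row d a n c"
  shows "b = c"
proof
  fix k
  show "b k = c k"
  proof (induction k rule: less_induct)
    case (less k)
    show ?case
    proof (cases "k \<le> n")
      case False
      thus ?thesis using assms by (simp add: is_S2_row_def)
    next
      case True
      define t where "t m = [:0, 1:] ^ m * (pderiv ^^ m) (monom 1 k :: real poly)" for m
      have eq: "(\<Sum>m\<le>n. smult (b m) (t m)) = (\<Sum>m\<le>n. smult (c m) (t m))"
        using assms unfolding is_S2_row_def t_def by metis
      have t0: "t m = 0" if "m > k" for m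
        by (simp add: t_def pderiv_funpow_monom_zero that)
      have tk: "t k \<noteq> 0"
        by (simp add: t_def pderiv_funpow_monom_self)
      have "(\<Sum>m\<le>n. smult (b m - c m) (t m)) = 0"
        using eq by (simp add: smult_diff_left sum_subtractf)
      moreover have "(\<Sum>m\<le>n. smult (b m - c m) (t m)) = (\<Sum>m\<in>{k}. smult (b m - c m) (t m))"
        by (rule sum.mono_neutral_right)
           (use True less t0 in \<open>auto simp: not_less_iff_gr_or_eq dest: linorder_neqE_nat\<close>)
      ultimately show ?thesis using tk by simp
    qed
  qed
qed

lemma is_S2_row_ex1: "\<exists>!c. is_S2_row d a n c"
  using is_S2_row_ex is_S2_row_unique by blast

lemma is_S2_row_S2: "is_S2_row d a n (S2 d a n)"
  unfolding S2_def using is_S2_row_ex1 by (rule theI')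

end

(*
  Applying the defining operator identity to x^j, an eigenvector of a + d E_x with eigenvalue
  a + d j, gives (a + d j)^n = sum_m S2(n,m) m! binom(j,m).  Substituting this into the right-hand
  side and exchanging the sums leaves a convolution of binomial coefficients, which
  Vandermonde's identity with upper indices n + 1 and -(m + 1) evaluates.
*)
theory Submission imports Defs "HOL-Computational_Algebra.Formal_Power_Series" begin

lemma choose_Suc_times: "Suc m * (k choose Suc m) = (k - m) * (k choose m)"
  by (cases k) (simp_all only: binomial_absorb_comp Suc_times_binomial diff_Suc_1, simp)

text \<open>The falling factorial of \<open>k\<close> is written as \<open>fact m\<close> times a
  binomial coefficient, which vanishes for \<open>m > k\<close>, so the truncated exponent
  \<open>k - m\<close> does no harm.\<close>

lemma pderiv_funpow_monom:
  "(pderiv ^^ m) (monom c k :: real poly) = monom (c * fact m * real (k choose m)) (k - m)"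
proof (induction m)
  case (Suc m)
  have "real (k - m) * real (k choose m) = real (Suc m) * real (k choose Suc m)"
    using choose_Suc_times[of m k] by (metis of_nat_mult)
  hence "real (k - m) * (c * fact m * real (k choose m)) =
      c * fact (Suc m) * real (k choose Suc m)"
    by (simp add: mult.left_commute mult.assoc)
  then show ?case
    by (simp add: Suc pderiv_monom)
qed simp

lemma scaled_euler_op_funpow_monom:
  "(scaled_euler_op d a ^^ n) (monom c k) = monom ((real a + real d * real k) ^ n * c) k"
proof (induction n)
  case (Suc n)
  have "euler_op (monom b k) = monom (real k * b) k" for b
    by (cases k) (simp_all only: euler_op_def pderiv_monom, simp_all add: monom_Suc)
  hence "scaled_euler_op d a (monom b k) = monom ((real a + real d * real k) * b) k" for b
    by (simp add: scaled_euler_op_def smult_monom add_monom algebra_simps)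
  then show ?case
    by (simp add: Suc mult.assoc)
qed simp

lemma power_eq_sum_S2:
  "(real a + real d * real k) ^ n = (\<Sum>m\<le>n. S2 d a n m * fact m * real (k choose m))"
proof -
  have "(scaled_euler_op d a ^^ n) (monom 1 k)
      = (\<Sum>m\<le>n. smult (S2 d a n m) ([:0, 1:] ^ m * (pderiv ^^ m) (monom 1 k)))"
    using is_S2_row_S2[of d a n] unfolding is_S2_row_def by blast
  \<comment> \<open>Both sides are multiples of \<open>monom 1 k\<close>; evaluation at 1 reads off
    the factor.\<close>
  from arg_cong[OF this, of "\<lambda>p. poly p 1"] show ?thesis
    by (simp add: scaled_euler_op_funpow_monom pderiv_funpow_monom poly_monom poly_sum mult.assoc)
qed

text \<open>Both sides are the coefficient of x^k in (1 - x)^(n+1) * x^m / (1 - x)^(m+1) = x^m * (1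
  - x)^(n-m).\<close>

lemma sum_alternating_choose_mult_choose:
  assumes "m \<le> n" "m \<le> k"
  shows "(\<Sum>j=0..k. (- 1) ^ (k - j) * real (Suc n choose (k - j)) * real (j choose m))
       = (- 1) ^ (k - m) * real ((n - m) choose (k - m))"
proof -
  define K where "K = k - m"
  have k: "k = K + m"
    using assms by (simp add: K_def)
  \<comment> \<open>Upper negation moves the summation index to the lower argument, where
    Vandermonde's identity needs it.\<close>
  have neg: "real ((i + m) choose m) = (- 1) ^ i * ((- (real m + 1)) gchoose i)" for i
  proof -
    have "real ((i + m) choose m) = real ((i + m) choose i)"
      by (subst binomial_symmetric) simp_all
    also have "\<dots> = (- 1) ^ i * ((- (real m + 1)) gchoose i)"
      using gbinomial_minus[of "real m + 1" i]
      by (simp add: binomial_gbinomial add.commute)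
    finally show ?thesis .
  qed
  \<comment> \<open>Terms with \<open>j < m\<close> vanish, so the sum may start at \<open>m\<close>
    and be reindexed by j = i + m.\<close>
  have "(\<Sum>j=0..k. (- 1) ^ (k - j) * real (Suc n choose (k - j)) * real (j choose m))
      = (\<Sum>j=0+m..K+m. (- 1) ^ (k - j) * real (Suc n choose (k - j)) * real (j choose m))"
    unfolding k by (rule sum.mono_neutral_right) auto
  also have "\<dots> = (\<Sum>i=0..K. (- 1) ^ (K - i) * real (Suc n choose (K - i)) * real ((i + m) choose m))"
    by (subst sum.shift_bounds_cl_nat_ivl) (simp add: k)
  \<comment> \<open>The sign from \<open>neg\<close> merges with the alternating one into a
    constant, leaving a pure convolution.\<close>
  also have "\<dots> = (\<Sum>i=0..K. (- 1) ^ K *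
      (((- (real m + 1)) gchoose i) * (real (Suc n) gchoose (K - i))))"
  proof (rule sum.cong[OF refl])
    fix i assume "i \<in> {0..K}"
    hence "(- 1) ^ (K - i) * (- 1) ^ i = (- 1 :: real) ^ K"
      by (simp flip: power_add)
    hence "(- 1) ^ (K - i) * x * ((- 1) ^ i * y) = (- 1) ^ K * (y * x)" for x y :: real
      by (metis mult.assoc mult.commute)
    then show "(- 1) ^ (K - i) * real (Suc n choose (K - i)) * real ((i + m) choose m) =
        (- 1) ^ K * (((- (real m + 1)) gchoose i) * (real (Suc n) gchoose (K - i)))"
      by (simp add: neg binomial_gbinomial[of "Suc n"] del: of_nat_Suc)
  qed
  also have "\<dots> = (- 1) ^ K * ((- (real m + 1) + real (Suc n)) gchoose K)"
    by (simp only: gbinomial_Vandermonde flip: sum_distrib_left)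
  \<comment> \<open>Here \<open>m \<le> n\<close> makes the upper index a natural number, so
    \<open>gchoose\<close> becomes an ordinary binomial.\<close>
  also have "- (real m + 1) + real (Suc n) = real (n - m)"
    using assms by (simp add: of_nat_diff)
  finally show ?thesis
    by (simp add: K_def binomial_gbinomial)
qed

theorem mainTheorem9:
  fixes d a n k :: nat
  assumes "d \<ge> 1" and "k \<le> n"
  shows "rEu d a n k =
    (\<Sum>j=0..k. (- 1) ^ (k - j) * real ((n + 1) choose (k - j)) * (real a + real d * real j) ^ n)"
proof -
  let ?w = "\<lambda>j. (- 1) ^ (k - j) * real (Suc n choose (k - j))"
  let ?T = "\<lambda>m. S2 d a n m * fact m"
  have "(\<Sum>j=0..k. ?w j * (real a + real d * real j) ^ n)
      = (\<Sum>j=0..k. \<Sum>m\<le>n. ?T m * (?w j * real (j choose m)))"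
    by (simp only: power_eq_sum_S2 sum_distrib_left) (simp only: mult_ac)
  also have "\<dots> = (\<Sum>m\<le>n. ?T m * (\<Sum>j=0..k. ?w j * real (j choose m)))"
    by (subst sum.swap) (simp add: sum_distrib_left)
  \<comment> \<open>For \<open>m > k\<close> every \<open>j choose m\<close> with
    \<open>j \<le> k\<close> is 0; \<open>k \<le> n\<close> ensures that no index is added.\<close>
  also have "\<dots> = (\<Sum>m=0..k. ?T m * (\<Sum>j=0..k. ?w j * real (j choose m)))"
    by (rule sum.mono_neutral_right) (use assms in \<open>auto intro!: sum.neutral\<close>)
  also have "\<dots> = (\<Sum>m=0..k. ?T m * ((- 1) ^ (k - m) * real ((n - m) choose (k - m))))"
    using assms by (intro sum.cong refl) (simp add: sum_alternating_choose_mult_choose)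
  also have "\<dots> = rEu d a n k"
    by (simp add: rEu_def mult_ac)
  finally show ?thesis
    by simp
qed

end
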